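(* Let $n\ge1$ be an integer, $k\ge\frac{n-1}{2n}$, $p\in[1,+\infty]$, $a>0$, and let $f$ be a measurable function on $\mathbb{R}$ such that $x\mapsto e^{na|x|^{2/n}}f(x)$ belongs to $L^p_{k,n}$. Then $\mathcal{T}_1f(z)$ is well defined for every $z\in\mathbb{C}$, $\mathcal{T}_1 f$ is an entire function, and there is a constant $C>0$ (independent of $z$) such that $$|\mathcal{T}_1f(z)|\le C\,e^{\frac{n}{4a}(\operatorname{Im} z)^2}\qquad\text{for all }z\in\mathbb{C}.$$
   Context: Notation: $\alpha=kn-\frac n2$; $j_\beta(z)=\Gamma(\beta+1)\sum_{m\ge0}\frac{(-1)^m}{m!\,\Gamma(\beta+m+1)}(z/2)^{2m}$ is the normalized Bessel function; $d\mu_{k,n}(x)=\frac{1}{2\Gamma(kn-\frac n2+1)}(\frac n2)^{kn-\frac n2}|x|^{2k+\frac2n-2}dx$ and $L^p_{k,n}=L^p(\mathbb{R},d\mu_{k,n})$. For a function $f$, $f_e(x)=\frac{f(x)+f(-x)}2$ and $f_o(x)=\frac{f(x)-f(-x)}2$. Define for $z\in\mathbb{C}$ $$\mathcal{T}_1f(z)=\int_{\mathbb{R}} f_e(u)\,j_{kn-\frac n2}\big(nz|u|^{1/n}\big)\,d\mu_{k,n}(u).$$ *)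

theory Defs
  imports "HOL-Analysis.Analysis"
begin

definition bessel_j :: "real \<Rightarrow> complex \<Rightarrow> complex" where
  "bessel_j \<beta> z = complex_of_real (Gamma (\<beta> + 1)) *
     (\<Sum>m. complex_of_real ((-1) ^ m / (fact m * Gamma (\<beta> + real m + 1))) * (z / 2) ^ (2 * m))"

definition alpha_kn :: "real \<Rightarrow> nat \<Rightarrow> real" where
  "alpha_kn k n = k * real n - real n / 2"

definition mu_kn :: "real \<Rightarrow> nat \<Rightarrow> real measure" where
  "mu_kn k n = density lborel (\<lambda>x. ennreal
      (1 / (2 * Gamma (alpha_kn k n + 1)) * (real n / 2) powr (alpha_kn k n)
       * \<bar>x\<bar> powr (2 * k + 2 / real n - 2)))"

definition in_Lp :: "real measure \<Rightarrow> ennreal \<Rightarrow> (real \<Rightarrow> complex) \<Rightarrow> bool" where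
  "in_Lp M p g \<longleftrightarrow> g \<in> borel_measurable M \<and>
     (if p = \<infinity> then (\<exists>C. AE x in M. norm (g x) \<le> C)
      else integrable M (\<lambda>x. norm (g x) powr enn2real p))"

definition even_part :: "(real \<Rightarrow> complex) \<Rightarrow> real \<Rightarrow> complex" where
  "even_part f x = (f x + f (- x)) / 2"

definition T1_integrand :: "real \<Rightarrow> nat \<Rightarrow> (real \<Rightarrow> complex) \<Rightarrow> complex \<Rightarrow> real \<Rightarrow> complex" where
  "T1_integrand k n f z u =
     even_part f u * bessel_j (alpha_kn k n) (of_nat n * z * complex_of_real (\<bar>u\<bar> powr (1 / real n)))"

definition T1 :: "real \<Rightarrow> nat \<Rightarrow> (real \<Rightarrow> complex) \<Rightarrow> complex \<Rightarrow> complex" where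
  "T1 k n f z = (LINT u|mu_kn k n. T1_integrand k n f z u)"

end

theory Submission
  imports Defs "HOL-Probability.Giry_Monad"
begin

text \<open>
  Write \<open>\<alpha>\<close> for \<open>alpha_kn k n\<close>, so \<open>\<alpha> \<ge> -1/2\<close>. Poisson's representation exhibits \<open>j\<^sub>\<alpha>(z)\<close> as the
  average of \<open>cos (z \<surd>s)\<close> over a probability measure on \<open>[0, 1]\<close>, whence
  \<open>\<bar>j\<^sub>\<alpha>(z)\<bar> \<le> I(Im z)\<close> with \<open>I(y) = j\<^sub>\<alpha>(\<i>y) \<le> exp \<bar>y\<bar>\<close>. Put \<open>r = \<bar>u\<bar>\<^bsup>1/n\<^esup>\<close> and
  \<open>G(u) = exp (- n a r\<^sup>2) I(n y r)\<close>. Completing the square gives \<open>G \<le> exp (n y\<^sup>2 / 4a)\<close> pointwise, and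
  integrating the series of \<open>I\<close> termwise against the Gaussian gives \<open>\<integral> G d\<mu> = C exp (n y\<^sup>2 / 4a)\<close>
  exactly. Since \<open>F = exp (n a r\<^sup>2) \<bar>f\<bar>\<close> satisfies \<open>F \<le> 1 + F\<^sup>p\<close> (or is bounded, for \<open>p = \<infinity>\<close>), these two
  bounds handle every \<open>p\<close> at once. The crude bound \<open>\<bar>j\<^sub>\<alpha>(z)\<bar> \<le> exp \<bar>Im z\<bar>\<close> alone fails for \<open>\<alpha> > -1/2\<close> and
  \<open>p > 1\<close>. The same domination by \<open>I(n \<bar>z\<bar> r)\<close> allows termwise integration of the series of \<open>j\<^sub>\<alpha>\<close>,
  which expands the transform as an everywhere convergent power series in \<open>z\<^sup>2\<close>.
\<close>

section \<open>Moments of the Beta distribution\<close>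

text \<open>The \<open>m\<close>-th moment of Beta(1/2, \<open>\<alpha> + 1/2\<close>). Written with
  Pochhammer symbols instead of Beta values, it still makes sense at \<open>\<alpha> = -1/2\<close>,
  where it is constantly 1.\<close>

definition beta_moment :: "real \<Rightarrow> nat \<Rightarrow> real" where
  "beta_moment \<alpha> m = pochhammer (1/2) m / pochhammer (\<alpha> + 1) m"

text \<open>The modified Bessel function, normalized to be 1 at 0. Displaying the moments in the
  coefficients lets the series be compared term by term with that of \<open>cosh\<close>.\<close>

definition bessel_i :: "real \<Rightarrow> real \<Rightarrow> real" where
  "bessel_i \<alpha> x = (\<Sum>m. beta_moment \<alpha> m / fact (2 * m) * x ^ (2 * m))"

lemma beta_moment_nonneg: "\<alpha> \<ge> -1/2 \<Longrightarrow> 0 \<le> beta_moment \<alpha> m"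
  unfolding beta_moment_def by (intro divide_nonneg_pos pochhammer_nonneg pochhammer_pos) auto

lemma beta_moment_le_1:
  assumes "\<alpha> \<ge> -1/2"
  shows "beta_moment \<alpha> m \<le> 1"
proof -
  \<comment> \<open>The factors \<open>1/2 + i\<close> and \<open>\<alpha> + 1 + i\<close> are
    compared one by one.\<close>
  have "pochhammer (1/2) m \<le> pochhammer (\<alpha> + 1) m"
    unfolding pochhammer_prod using assms by (intro prod_mono) auto
  moreover have "pochhammer (\<alpha> + 1) m > 0"
    using assms by (intro pochhammer_pos) auto
  ultimately show ?thesis
    by (simp add: beta_moment_def)
qed

text \<open>The Beta(1/2, \<open>\<alpha> + 1/2\<close>) distribution, degenerating to the point mass at 1 for \<open>\<alpha> = -1/2\<close>.\<close>

lemma exists_beta_moment_measure: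
  assumes "\<alpha> \<ge> -1/2"
  obtains \<nu> :: "real measure" where "prob_space \<nu>" "sets \<nu> = sets borel"
    "AE s in \<nu>. s \<in> {0..1}" "\<And>m. has_bochner_integral \<nu> (\<lambda>s. s ^ m) (beta_moment \<alpha> m)"
proof (cases "\<alpha> = -1/2")
  case True
  define \<nu> where "\<nu> = return borel (1::real)"
  show ?thesis
  proof
    show "prob_space \<nu>" unfolding \<nu>_def by (rule prob_space_return) simp
    then interpret prob_space \<nu> .
    show "sets \<nu> = sets borel" by (simp add: \<nu>_def)
    show "AE s in \<nu>. s \<in> {0..1}" unfolding \<nu>_def by (subst AE_return) auto
    fix m :: nat
    have "pochhammer (1/2) m > (0::real)" by (rule pochhammer_pos) simp
    then have "beta_moment \<alpha> m = 1"
      by (simp add: beta_moment_def True)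
    moreover have "(\<integral>\<^sup>+ s. ennreal (s ^ m) \<partial>\<nu>) = 1"
      unfolding \<nu>_def by (subst nn_integral_return) auto
    moreover have "AE s in \<nu>. 0 \<le> s ^ m"
      unfolding \<nu>_def by (subst AE_return) auto
    ultimately show "has_bochner_integral \<nu> (\<lambda>s. s ^ m) (beta_moment \<alpha> m)"
      by (intro has_bochner_integral_nn_integral) (auto simp: \<nu>_def)
  qed
next
  case False
  with assms have \<alpha>: "\<alpha> > -1/2" by simp
  define B where "B = Beta (1/2) (\<alpha> + 1/2)"
  have B: "B > 0"
    unfolding B_def Beta_def using \<alpha> by (intro divide_pos_pos mult_pos_pos) auto
  define w where "w s = s powr (-1/2) * (1 - s) powr (\<alpha> - 1/2) * indicator {0..1} s / B" for s :: real
  have w_meas [measurable]: "w \<in> borel_measurable borel"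
    unfolding w_def by measurable
  have w_nonneg: "w s \<ge> 0" for s
    using B by (simp add: w_def)
  define \<nu> where "\<nu> = density lborel (\<lambda>s. ennreal (w s))"
  have mom: "(\<integral>\<^sup>+ s. ennreal (s ^ m) \<partial>\<nu>) = ennreal (beta_moment \<alpha> m)" for m
  proof -
    have "((\<lambda>s. s powr (m + 1/2 - 1) * (1 - s) powr (\<alpha> + 1/2 - 1)) has_integral
        Beta (m + 1/2) (\<alpha> + 1/2)) {0..1}"
      using \<alpha> by (intro has_integral_Beta_real) auto
    then have "((\<lambda>s. s powr (m + 1/2 - 1) * (1 - s) powr (\<alpha> + 1/2 - 1) / B) has_integral
        Beta (m + 1/2) (\<alpha> + 1/2) / B) {0..1}"
      by (rule has_integral_divide)
    then have "(\<integral>\<^sup>+ s. ennreal (s powr (m + 1/2 - 1) * (1 - s) powr (\<alpha> + 1/2 - 1) / B) * indicator {0..1} s \<partial>lborel)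
        = ennreal (Beta (m + 1/2) (\<alpha> + 1/2) / B)"
      using B by (intro nn_integral_has_integral_lebesgue') auto
    also have "(\<integral>\<^sup>+ s. ennreal (s powr (m + 1/2 - 1) * (1 - s) powr (\<alpha> + 1/2 - 1) / B) * indicator {0..1} s \<partial>lborel)
        = (\<integral>\<^sup>+ s. ennreal (w s) * ennreal (s ^ m) \<partial>lborel)"
    proof (rule nn_integral_cong_AE)
      \<comment> \<open>Splitting \<open>s powr (m - 1/2)\<close> into
        \<open>s powr (-1/2) * s ^ m\<close> is done for \<open>s > 0\<close>, so the null set
        \<open>{0}\<close> is discarded.\<close>
      have "AE s in lborel. s \<noteq> (0::real)"
        by (rule AE_lborel_singleton)
      then show "AE s in lborel. ennreal (s powr (m + 1/2 - 1) * (1 - s) powr (\<alpha> + 1/2 - 1) / B) * indicator {0..1} s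
          = ennreal (w s) * ennreal (s ^ m)"
      proof eventually_elim
        case (elim s)
        show ?case
        proof (cases "s \<in> {0..1}")
          case True
          with elim have s: "s > 0" by auto
          have "s powr (m + 1/2 - 1) = s powr (-1/2) * s ^ m"
            using s by (simp add: powr_add[symmetric] powr_realpow[symmetric] add_ac)
          then show ?thesis
            using True s B by (simp add: w_def ennreal_mult[symmetric])
        qed (simp add: w_def)
      qed
    qed
    also have "\<dots> = (\<integral>\<^sup>+ s. ennreal (s ^ m) \<partial>\<nu>)"
      unfolding \<nu>_def by (subst nn_integral_density) auto
    \<comment> \<open>Both Beta values contain the factor \<open>Gamma (\<alpha> + 1/2)\<close>,
      which cancels; the remaining ratios of Gamma values are Pochhammer symbols.\<close>
    also have "Beta (m + 1/2) (\<alpha> + 1/2) / B = beta_moment \<alpha> m"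
    proof -
      have "Gamma (1/2 :: real) > 0" "Gamma (\<alpha> + 1/2) > 0" "Gamma (\<alpha> + 1) > 0"
        "Gamma (\<alpha> + 1 + real m) > 0"
        using \<alpha> by (auto intro!: Gamma_real_pos)
      moreover have "Beta (real m + 1/2) (\<alpha> + 1/2) = Gamma (1/2 + real m) * Gamma (\<alpha> + 1/2) / Gamma (\<alpha> + 1 + real m)"
        "B = Gamma (1/2) * Gamma (\<alpha> + 1/2) / Gamma (\<alpha> + 1)"
        by (simp_all add: B_def Beta_def add_ac)
      moreover have "pochhammer (1/2) m = Gamma (1/2 + real m) / Gamma (1/2 :: real)"
        by (rule pochhammer_Gamma) (auto elim!: nonpos_Ints_cases)
      moreover have "pochhammer (\<alpha> + 1) m = Gamma (\<alpha> + 1 + real m) / Gamma (\<alpha> + 1)"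
        using \<alpha> by (intro pochhammer_Gamma) (auto elim!: nonpos_Ints_cases)
      ultimately show ?thesis
        by (simp add: beta_moment_def)
    qed
    finally show ?thesis .
  qed
  show ?thesis
  proof
    show "prob_space \<nu>"
    proof
      have "emeasure \<nu> (space \<nu>) = (\<integral>\<^sup>+ s. ennreal (s ^ 0) \<partial>\<nu>)"
        by simp
      also have "\<dots> = 1"
        by (subst mom) (simp add: beta_moment_def)
      finally show "emeasure \<nu> (space \<nu>) = 1" .
    qed
    show "sets \<nu> = sets borel" by (simp add: \<nu>_def)
    show AE01: "AE s in \<nu>. s \<in> {0..1}"
      unfolding \<nu>_def by (subst AE_density) (auto simp: w_def indicator_def)
    show "has_bochner_integral \<nu> (\<lambda>s. s ^ m) (beta_moment \<alpha> m)" for m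
      using mom[of m] AE01 assms
      by (intro has_bochner_integral_nn_integral beta_moment_nonneg) (auto simp: \<nu>_def)
  qed
qed

section \<open>Power series of the Bessel functions\<close>

text \<open>The full cosine series is grouped into blocks of two consecutive terms; the odd one in
  each block vanishes.\<close>

lemma cos_even_sums:
  fixes z :: complex
  shows "(\<lambda>m. complex_of_real ((-1) ^ m / fact (2 * m)) * z ^ (2 * m)) sums cos z"
proof -
  have "(\<lambda>m. \<Sum>k = m * 2..<m * 2 + 2. cos_coeff k *\<^sub>R z ^ k) sums cos z"
    by (rule sums_group) (use cos_converges [of z] in auto)
  then show ?thesis
    by (simp add: cos_coeff_def scaleR_conv_of_real ac_simps)
qed

lemma cosh_even_sums:
  fixes x :: real
  shows "(\<lambda>m. x ^ (2 * m) / fact (2 * m)) sums cosh x"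
proof -
  have "(\<lambda>m. \<Sum>k = m * 2..<m * 2 + 2. if even k then x ^ k /\<^sub>R fact k else 0) sums cosh x"
    by (rule sums_group) (use cosh_converges [of x] in auto)
  then show ?thesis
    by (simp add: ac_simps divide_inverse)
qed

lemma norm_cos_le_cosh: "norm (cos z) \<le> cosh (Im z)"
proof -
  have "norm (cos z) \<le> (norm (exp (\<i> * z)) + norm (exp (- \<i> * z))) / 2"
    using norm_triangle_ineq[of "exp (\<i> * z)" "exp (- \<i> * z)"]
    unfolding cos_exp_eq by (simp add: norm_divide del: norm_exp_eq_Re)
  also have "\<dots> = cosh (Im z)"
    by (simp add: cosh_field_def)
  finally show ?thesis .
qed

lemma cosh_le_exp_abs: "cosh (x::real) \<le> exp \<bar>x\<bar>"
proof -
  have "exp x + exp (-x) \<le> exp \<bar>x\<bar> + exp \<bar>x\<bar>" by (intro add_mono) auto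
  then show ?thesis by (simp add: cosh_field_def)
qed

lemma bessel_i_term_nonneg: "\<alpha> \<ge> -1/2 \<Longrightarrow> 0 \<le> beta_moment \<alpha> m / fact (2 * m) * x ^ (2 * m)" for x :: real
  by (simp add: beta_moment_nonneg)

lemma bessel_i_term_le:
  fixes x :: real
  assumes "\<alpha> \<ge> -1/2"
  shows "beta_moment \<alpha> m / fact (2 * m) * x ^ (2 * m) \<le> x ^ (2 * m) / fact (2 * m)"
  using mult_right_mono[OF beta_moment_le_1[OF assms, of m], of "x ^ (2 * m) / fact (2 * m)"] by simp

lemma bessel_i_sums:
  assumes "\<alpha> \<ge> -1/2"
  shows "(\<lambda>m. beta_moment \<alpha> m / fact (2 * m) * x ^ (2 * m)) sums bessel_i \<alpha> x"
  unfolding bessel_i_def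
proof (rule summable_sums, rule summable_comparison_test')
  show "summable (\<lambda>m. x ^ (2 * m) / fact (2 * m))"
    using cosh_even_sums by (rule sums_summable)
  show "norm (beta_moment \<alpha> m / fact (2 * m) * x ^ (2 * m)) \<le> x ^ (2 * m) / fact (2 * m)" for m
    using bessel_i_term_le[OF assms, of m x] bessel_i_term_nonneg[OF assms, of m x]
    by (simp only: real_norm_def abs_of_nonneg)
qed

lemma bessel_i_nonneg: "\<alpha> \<ge> -1/2 \<Longrightarrow> 0 \<le> bessel_i \<alpha> x"
  using sums_le[OF bessel_i_term_nonneg sums_zero bessel_i_sums] by blast

text \<open>Since the moments are at most 1, the series is dominated term by term by that of
  \<open>cosh\<close>.\<close>

lemma bessel_i_le_exp:
  assumes "\<alpha> \<ge> -1/2"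
  shows "bessel_i \<alpha> x \<le> exp \<bar>x\<bar>"
proof -
  have "bessel_i \<alpha> x \<le> cosh x"
    by (rule sums_le[OF bessel_i_term_le bessel_i_sums cosh_even_sums]) fact+
  also have "\<dots> \<le> exp \<bar>x\<bar>" by (rule cosh_le_exp_abs)
  finally show ?thesis .
qed

lemma bessel_i_measurable [measurable]:
  assumes [measurable]: "g \<in> borel_measurable M"
  shows "(\<lambda>x. bessel_i \<alpha> (g x)) \<in> borel_measurable M"
  unfolding bessel_i_def by measurable

text \<open>Links the moment form of the coefficients to the Gamma form in \<open>bessel_j\<close>.
  By the duplication formula \<open>fact_double\<close>, \<open>(2m)!\<close> contains the factor
  \<open>pochhammer (1/2) m\<close>, which cancels the numerator of the moment.\<close>

lemma beta_moment_Gamma: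
  assumes "\<alpha> \<ge> -1/2"
  shows "beta_moment \<alpha> m / fact (2 * m) = Gamma (\<alpha> + 1) / (fact m * Gamma (\<alpha> + real m + 1)) * (1 / 2) ^ (2 * m)"
proof -
  have pos: "Gamma (\<alpha> + 1) > 0" "Gamma (\<alpha> + real m + 1) > 0" "pochhammer (1/2) m > (0::real)"
    using assms by (auto intro!: Gamma_real_pos pochhammer_pos)
  have p: "pochhammer (\<alpha> + 1) m = Gamma (\<alpha> + 1 + real m) / Gamma (\<alpha> + 1)"
    using assms by (intro pochhammer_Gamma) (auto elim!: nonpos_Ints_cases)
  show ?thesis
    unfolding beta_moment_def p fact_double using pos by (simp add: field_simps power_divide)
qed

lemma bessel_j_sums:
  assumes "\<alpha> \<ge> -1/2"
  shows "(\<lambda>m. complex_of_real ((-1) ^ m * (beta_moment \<alpha> m / fact (2 * m))) * z ^ (2 * m)) sums bessel_j \<alpha> z"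
proof -
  let ?t = "\<lambda>m. complex_of_real ((-1) ^ m / (fact m * Gamma (\<alpha> + real m + 1))) * (z / 2) ^ (2 * m)"
  let ?u = "\<lambda>m. complex_of_real ((-1) ^ m * (beta_moment \<alpha> m / fact (2 * m))) * z ^ (2 * m)"
  have G: "Gamma (\<alpha> + 1) > 0" using assms by auto
  have eq: "?u m = complex_of_real (Gamma (\<alpha> + 1)) * ?t m" for m
    unfolding beta_moment_Gamma[OF assms] by (simp add: power_divide)
  have "summable ?u"
  \<comment> \<open>Convergence is absolute: the norms of the terms are exactly the terms of
    \<open>bessel_i\<close> at \<open>norm z\<close>.\<close>
  proof (rule summable_norm_cancel, rule summable_cong[THEN iffD1, OF _ sums_summable[OF bessel_i_sums[OF assms, of "norm z"]]])
    show "\<forall>\<^sub>F m in sequentially. beta_moment \<alpha> m / fact (2 * m) * norm z ^ (2 * m) = norm (?u m)"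
      using beta_moment_nonneg[OF assms] by (simp add: norm_mult norm_power norm_divide)
  qed
  then have "summable ?t"
    unfolding eq using G by (subst (asm) summable_cmult_iff) auto
  then show ?thesis
    unfolding bessel_j_def eq by (intro sums_mult summable_sums)
qed

lemma bessel_j_measurable [measurable]:
  assumes [measurable]: "g \<in> borel_measurable M"
  shows "(\<lambda>x. bessel_j \<alpha> (g x)) \<in> borel_measurable M"
  unfolding bessel_j_def by measurable

text \<open>The sign \<open>(-1) ^ m\<close> is cancelled by \<open>\<i> ^ (2 * m)\<close>.\<close>

lemma bessel_j_imaginary:
  assumes "\<alpha> \<ge> -1/2"
  shows "bessel_j \<alpha> (\<i> * complex_of_real x) = complex_of_real (bessel_i \<alpha> x)"
proof -
  have "(\<lambda>m. complex_of_real (beta_moment \<alpha> m / fact (2 * m) * x ^ (2 * m))) sums bessel_j \<alpha> (\<i> * complex_of_real x)"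
  proof -
    have "complex_of_real ((-1) ^ m * c) * (\<i> * complex_of_real x) ^ (2 * m) = complex_of_real (c * x ^ (2 * m))" for c m
    proof -
      have "(-1 :: complex) ^ m * \<i> ^ (2 * m) = 1"
        by (simp add: power_mult flip: power_mult_distrib)
      then show ?thesis
        by (simp add: power_mult_distrib algebra_simps)
    qed
    then show ?thesis
      using bessel_j_sums[OF assms, of "\<i> * complex_of_real x"] by (simp only:)
  qed
  then show ?thesis
    using sums_of_real[OF bessel_i_sums[OF assms, of x]] sums_unique2 by blast
qed

section \<open>Poisson's representation and the bound by the modified Bessel function\<close>

text \<open>The cosine series is integrated term by term. As
  \<open>(sqrt s) ^ (2 * m) = s ^ m\<close> for \<open>s \<ge> 0\<close>, each term contributes a
  moment, which produces the coefficients of \<open>bessel_j_sums\<close>. On \<open>[0, 1]\<close>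
  the terms are dominated by the summable constants \<open>norm (?c m)\<close>, which are integrable
  because the total mass is 1.\<close>

lemma bessel_j_eq_integral_cos:
  assumes \<alpha>: "\<alpha> \<ge> -1/2" and "prob_space \<nu>" and sets: "sets \<nu> = sets borel"
    and AE01: "AE s in \<nu>. s \<in> {0..1}"
    and mom: "\<And>m. has_bochner_integral \<nu> (\<lambda>s. s ^ m) (beta_moment \<alpha> m)"
  shows "has_bochner_integral \<nu> (\<lambda>s. cos (z * complex_of_real (sqrt s))) (bessel_j \<alpha> z)"
proof -
  interpret prob_space \<nu> by fact
  note [measurable_cong] = sets
  let ?c = "\<lambda>m. complex_of_real ((-1) ^ m / fact (2 * m)) * z ^ (2 * m)"
  let ?g = "\<lambda>m s. ?c m * complex_of_real (s ^ m)"
  have int: "has_bochner_integral \<nu> (?g m) (?c m * complex_of_real (beta_moment \<alpha> m))" for m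
    by (intro has_bochner_integral_mult_right has_bochner_integral_of_real mom)
  have norm_c: "norm (?c m) = norm z ^ (2 * m) / fact (2 * m)" for m
    by (simp add: norm_mult norm_power norm_divide)
  have summ: "summable (\<lambda>m. norm (?c m))"
    unfolding norm_c using cosh_even_sums by (rule sums_summable)
  have norm_g: "norm (?g m s) \<le> norm (?c m)" if "s \<in> {0..1}" for m s
  proof -
    have "norm (?g m s) = norm (?c m) * s ^ m"
      using that by (simp only: norm_mult[of "?c m"] norm_of_real) simp
    also have "\<dots> \<le> norm (?c m) * 1"
      using that by (intro mult_left_mono power_le_one) auto
    finally show ?thesis by simp
  qed
  have cos_eq: "AE s in \<nu>. cos (z * complex_of_real (sqrt s)) = (\<Sum>m. ?g m s)"
    using AE01
  proof eventually_elim
    case (elim s)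
    have "(z * complex_of_real (sqrt s)) ^ (2 * m) = z ^ (2 * m) * complex_of_real (s ^ m)" for m
      using elim by (simp add: power_mult_distrib power_mult[of "sqrt s"] flip: of_real_power)
    then have "(\<lambda>m. ?g m s) sums cos (z * complex_of_real (sqrt s))"
      using cos_even_sums[of "z * complex_of_real (sqrt s)"] by (simp add: mult.assoc)
    then show ?case by (simp add: sums_unique)
  qed
  have 1: "AE s in \<nu>. summable (\<lambda>m. norm (?g m s))"
    using AE01
  proof eventually_elim
    case (elim s)
    show ?case
      by (rule summable_comparison_test'[OF summ]) (use norm_g[OF elim] in simp)
  qed
  have 2: "summable (\<lambda>m. \<integral>s. norm (?g m s) \<partial>\<nu>)"
  proof (rule summable_comparison_test'[OF summ])
    fix m
    have "(\<integral>s. norm (?g m s) \<partial>\<nu>) \<le> (\<integral>s. norm (?c m) \<partial>\<nu>)"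
    proof (rule integral_mono_AE)
      show "integrable \<nu> (\<lambda>s. norm (?g m s))"
        using int by (auto simp: has_bochner_integral_iff)
      show "AE s in \<nu>. norm (?g m s) \<le> norm (?c m)"
        using AE01 by eventually_elim (rule norm_g)
    qed simp
    then show "norm (\<integral>s. norm (?g m s) \<partial>\<nu>) \<le> norm (?c m)"
      by (simp add: prob_space)
  qed
  have gi: "integrable \<nu> (?g m)" for m
    using int by (auto simp: has_bochner_integral_iff)
  have "integrable \<nu> (\<lambda>s. \<Sum>m. ?g m s)"
    by (rule integrable_suminf[OF gi 1 2])
  moreover have "(\<lambda>m. \<integral>s. ?g m s \<partial>\<nu>) sums (\<integral>s. (\<Sum>m. ?g m s) \<partial>\<nu>)"
    by (rule sums_integral[OF gi 1 2])
  moreover have "(\<integral>s. ?g m s \<partial>\<nu>) = complex_of_real ((-1) ^ m * (beta_moment \<alpha> m / fact (2 * m))) * z ^ (2 * m)" for m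
    using int[of m] by (simp add: has_bochner_integral_iff)
  ultimately have "has_bochner_integral \<nu> (\<lambda>s. \<Sum>m. ?g m s) (bessel_j \<alpha> z)"
    using bessel_j_sums[OF \<alpha>, of z] unfolding has_bochner_integral_iff by (simp only: sums_unique2)
  then show ?thesis
    using cos_eq by (subst has_bochner_integral_cong_AE) auto
qed

text \<open>The norm is taken inside Poisson's integral and \<open>norm_cos_le_cosh\<close> is
  applied before integrating. Keeping the average of \<open>cosh\<close>, instead of its maximum, is
  what gives \<open>bessel_i\<close> and not merely an exponential.\<close>

lemma norm_bessel_j_le:
  assumes "\<alpha> \<ge> -1/2"
  shows "norm (bessel_j \<alpha> z) \<le> bessel_i \<alpha> (Im z)"
proof -
  obtain \<nu> :: "real measure" where \<nu>: "prob_space \<nu>" "sets \<nu> = sets borel"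
    "AE s in \<nu>. s \<in> {0..1}" "\<And>m. has_bochner_integral \<nu> (\<lambda>s. s ^ m) (beta_moment \<alpha> m)"
    using exists_beta_moment_measure[OF assms] by blast
  have j: "has_bochner_integral \<nu> (\<lambda>s. cos (w * complex_of_real (sqrt s))) (bessel_j \<alpha> w)" for w
    by (rule bessel_j_eq_integral_cos[OF assms \<nu>])
  have "cos (\<i> * complex_of_real (Im z) * complex_of_real (sqrt s)) = complex_of_real (cosh (Im z * sqrt s))" for s
    by (simp add: cos_exp_eq cosh_field_def flip: exp_of_real mult.assoc)
  \<comment> \<open>The average of \<open>cosh (Im z * sqrt s)\<close> is Poisson's integral at the
    imaginary point \<open>\<i> * Im z\<close>, hence a value of \<open>bessel_i\<close>.\<close>
  then have i: "has_bochner_integral \<nu> (\<lambda>s. cosh (Im z * sqrt s)) (bessel_i \<alpha> (Im z))"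
    using j[of "\<i> * complex_of_real (Im z)"] unfolding bessel_j_imaginary[OF assms]
    by (auto simp: has_bochner_integral_iff complex_of_real_integrable_eq)
  have "norm (bessel_j \<alpha> z) = norm (\<integral>s. cos (z * complex_of_real (sqrt s)) \<partial>\<nu>)"
    using j[of z] by (simp add: has_bochner_integral_iff)
  also have "\<dots> \<le> (\<integral>s. norm (cos (z * complex_of_real (sqrt s))) \<partial>\<nu>)"
    by (rule integral_norm_bound)
  also have "\<dots> \<le> (\<integral>s. cosh (Im z * sqrt s) \<partial>\<nu>)"
  proof (rule integral_mono)
    show "norm (cos (z * complex_of_real (sqrt s))) \<le> cosh (Im z * sqrt s)" for s
      using norm_cos_le_cosh[of "z * complex_of_real (sqrt s)"] by simp
  qed (use i j[of z] in \<open>auto simp: has_bochner_integral_iff\<close>)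
  also have "\<dots> = bessel_i \<alpha> (Im z)"
    using i by (simp add: has_bochner_integral_iff)
  finally show ?thesis .
qed

section \<open>Gaussian moments of the measure\<close>

text \<open>The substitution \<open>t = b * x powr e\<close>, whose inverse is the map
  \<open>g\<close> below, reduces this to Euler's integral for \<open>Gamma (s / e)\<close>.\<close>

lemma has_integral_powr_exp_powr:
  fixes s b e :: real
  assumes "s > 0" "b > 0" "e > 0"
  shows "((\<lambda>x. x powr (s - 1) * exp (- (b * x powr e))) has_integral
           Gamma (s / e) / (e * b powr (s / e))) {0<..}"
proof -
  define f where "f x = x powr (s - 1) * exp (- (b * x powr e))" for x :: real
  define g where "g t = (t / b) powr (1 / e)" for t :: real
  define g' where "g' t = (1 / e) * (t / b) powr (1 / e - 1) / b" for t :: real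
  have inv: "(g t) powr e = t / b" if "t > 0" for t
    using that assms by (simp add: g_def powr_powr)
  have der: "(g has_field_derivative g' t) (at t within {0<..})" if "t \<in> {0<..}" for t
    using that assms unfolding g_def g'_def
    by (auto intro!: derivative_eq_intros simp: field_simps)
  have inj: "inj_on g {0<..}"
  proof (rule inj_onI)
    fix x y assume xy: "x \<in> {0<..}" "y \<in> {0<..}" and "g x = g y"
    from \<open>g x = g y\<close> have "g x powr e = g y powr e" by (rule arg_cong)
    then have "x / b = y / b" using xy by (simp only: inv greaterThan_iff)
    then show "x = y" using assms by simp
  qed
  have img: "g ` {0<..} = {0<..}"
  proof
    show "g ` {0<..} \<subseteq> {0<..}" using assms by (auto simp: g_def)
    show "{0<..} \<subseteq> g ` {0<..}"
    proof
      fix x :: real assume "x \<in> {0<..}"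
      then have "x = g (b * x powr e)" "b * x powr e \<in> {0<..}"
        using assms by (auto simp: g_def powr_powr)
      then show "x \<in> g ` {0<..}" by blast
    qed
  qed
  \<comment> \<open>The derivative of \<open>g\<close> contributes the exponent
    \<open>1 / e - 1\<close> and the integrand \<open>(s - 1) / e\<close>; they add up to Euler's
    exponent \<open>s / e - 1\<close>.\<close>
  have eq: "\<bar>g' t\<bar> * f (g t) = t powr (s / e - 1) / exp t / (e * b powr (s / e))" if "t \<in> {0<..}" for t
  proof -
    have t: "t > 0" using that by simp
    have "\<bar>g' t\<bar> * f (g t) = ((t / b) powr (1 / e - 1) * (t / b) powr ((s - 1) / e)) * exp (- t) / (e * b)"
      using t assms by (simp add: g'_def f_def inv) (simp add: g_def powr_powr)
    also have "(t / b) powr (1 / e - 1) * (t / b) powr ((s - 1) / e) = (t / b) powr (s / e - 1)"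
      by (simp add: diff_divide_distrib flip: powr_add)
    also have "\<dots> = t powr (s / e - 1) / (b powr (s / e) / b)"
      using t assms by (simp add: powr_divide powr_diff)
    finally show ?thesis
      using assms by (simp add: exp_minus field_simps)
  qed
  have "((\<lambda>t. t powr (s / e - 1) / exp t) has_integral Gamma (s / e)) {0..}"
    using assms by (intro Gamma_integral_real) auto
  \<comment> \<open>The null set \<open>{0}\<close> is dropped because \<open>g\<close> is
    differentiated only at \<open>t > 0\<close>.\<close>
  then have "((\<lambda>t. t powr (s / e - 1) / exp t) has_integral Gamma (s / e)) {0<..}"
    by (rule has_integral_spike_set_eq[THEN iffD1, rotated 2])
      (auto intro: negligible_subset[of "{0}"])
  then have "((\<lambda>t. t powr (s / e - 1) / exp t / (e * b powr (s / e))) has_integral Gamma (s / e) / (e * b powr (s / e))) {0<..}"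
    by (rule has_integral_divide)
  then have hi: "((\<lambda>t. \<bar>g' t\<bar> * f (g t)) has_integral Gamma (s / e) / (e * b powr (s / e))) {0<..}"
    by (subst has_integral_cong[OF eq]) auto
  \<comment> \<open>The change of variables is applied to absolutely integrable functions;
    nonnegativity supplies this.\<close>
  then have "(\<lambda>t. \<bar>g' t\<bar> * f (g t)) absolutely_integrable_on {0<..}"
    by (intro nonnegative_absolutely_integrable_1) (auto simp: f_def)
  then have "f absolutely_integrable_on g ` {0<..} \<and> integral (g ` {0<..}) f = Gamma (s / e) / (e * b powr (s / e))"
    using has_absolute_integral_change_of_variables_1'[of "{0<..}" g g' f, OF _ der inj] hi
    by (auto simp: integral_unique)
  then have "(f has_integral Gamma (s / e) / (e * b powr (s / e))) {0<..}"
    unfolding img by (auto simp: has_integral_iff absolutely_integrable_on_def)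
  then show ?thesis unfolding f_def .
qed

lemma nn_integral_lborel_even:
  fixes h :: "real \<Rightarrow> ennreal"
  assumes [measurable]: "h \<in> borel_measurable borel" and "\<And>u. h (- u) = h u"
  shows "(\<integral>\<^sup>+ u. h u \<partial>lborel) = 2 * (\<integral>\<^sup>+ u. h u * indicator {0<..} u \<partial>lborel)"
proof -
  have "(\<integral>\<^sup>+ u. h u \<partial>lborel) = (\<integral>\<^sup>+ u. h u * indicator {0<..} u + h u * indicator {..<0} u \<partial>lborel)"
  proof (rule nn_integral_cong_AE)
    have "AE u in lborel. u \<noteq> (0::real)"
      by (rule AE_lborel_singleton)
    then show "AE u in lborel. h u = h u * indicator {0<..} u + h u * indicator {..<0} u"
      by eventually_elim (auto simp: indicator_def)
  qed
  also have "\<dots> = (\<integral>\<^sup>+ u. h u * indicator {0<..} u \<partial>lborel) + (\<integral>\<^sup>+ u. h u * indicator {..<0} u \<partial>lborel)"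
    by (rule nn_integral_add) auto
  also have "(\<integral>\<^sup>+ u. h u * indicator {..<0} u \<partial>lborel) = (\<integral>\<^sup>+ u. h u * indicator {0<..} u \<partial>lborel)"
    by (subst nn_integral_real_affine[of _ "-1" 0]) (auto simp: assms(2) indicator_def)
  finally show ?thesis by (simp add: mult_2)
qed

lemma sets_mu_kn [simp, measurable_cong]: "sets (mu_kn k n) = sets borel"
  by (simp add: mu_kn_def)

lemma nn_integral_mu_kn_reflect:
  assumes [measurable]: "h \<in> borel_measurable borel"
  shows "(\<integral>\<^sup>+ u. h (- u) \<partial>mu_kn k n) = (\<integral>\<^sup>+ u. h u \<partial>mu_kn k n)"
  unfolding mu_kn_def
  by (subst (1 2) nn_integral_density, simp_all, subst (2) nn_integral_real_affine[of _ "-1" 0]) auto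

text \<open>The lower bound on \<open>k\<close>, multiplied by \<open>n\<close>, reads
  \<open>k * n \<ge> (n - 1) / 2\<close>. All the Bessel estimates rest on this range of
  \<open>\<alpha>\<close>.\<close>

lemma alpha_kn_ge:
  assumes "n \<ge> 1" "k \<ge> (real n - 1) / (2 * real n)"
  shows "alpha_kn k n \<ge> -1/2"
proof -
  have "real n > 0" using assms(1) by simp
  with assms(2) show ?thesis
    by (simp add: alpha_kn_def field_simps)
qed

text \<open>The total mass of the Gaussian is this number times \<open>Gamma (\<alpha> + 1)\<close>;
  with the Gamma factor left out, one constant serves the moments of every order.\<close>

definition gaussian_mass :: "real \<Rightarrow> nat \<Rightarrow> real \<Rightarrow> real" where
  "gaussian_mass k n b = real n / (2 * Gamma (alpha_kn k n + 1)) * (real n / 2) powr alpha_kn k n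
     / b powr (alpha_kn k n + 1)"

lemma gaussian_moment_mu_kn:
  assumes n: "n \<ge> 1" and k: "k \<ge> (real n - 1) / (2 * real n)" and b: "b > 0"
  shows "(\<integral>\<^sup>+ u. ennreal (exp (- (b * \<bar>u\<bar> powr (2 / real n))) * (\<bar>u\<bar> powr (1 / real n)) ^ (2 * m)) \<partial>mu_kn k n)
     = ennreal (gaussian_mass k n b * Gamma (alpha_kn k n + real m + 1) / b ^ m)"
proof -
  define \<alpha> where "\<alpha> = alpha_kn k n"
  have \<alpha>: "\<alpha> \<ge> -1/2" using alpha_kn_ge[OF n k] by (simp add: \<alpha>_def)
  have n0: "real n > 0" using n by simp
  define c where "c = 1 / (2 * Gamma (\<alpha> + 1)) * (real n / 2) powr \<alpha>"
  have G: "Gamma (\<alpha> + 1) > 0" "Gamma (\<alpha> + real m + 1) > 0" using \<alpha> by auto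
  then have c: "c \<ge> 0" by (simp add: c_def)
  define e where "e = 2 / real n"
  have e: "e > 0" using n0 by (simp add: e_def)
  \<comment> \<open>Chosen so that \<open>s - 1\<close> collects the exponents of the density and of
    the monomial, while \<open>s / e\<close> becomes the Gamma argument
    \<open>\<alpha> + m + 1\<close>.\<close>
  define s where "s = (\<alpha> + real m + 1) * e"
  have s: "s > 0" using \<alpha> e by (simp add: s_def)
  have se: "s / e = \<alpha> + real m + 1" using e by (simp add: s_def)
  have s1: "s - 1 = 2 * k + 2 / real n - 2 + 2 * real m / real n"
    using n0 by (simp add: s_def e_def \<alpha>_def alpha_kn_def field_simps)
  have "(\<integral>\<^sup>+ u. ennreal (exp (- (b * \<bar>u\<bar> powr (2 / real n))) * (\<bar>u\<bar> powr (1 / real n)) ^ (2 * m)) \<partial>mu_kn k n)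
    = (\<integral>\<^sup>+ u. ennreal (c * \<bar>u\<bar> powr (2 * k + 2 / real n - 2)) *
         ennreal (exp (- (b * \<bar>u\<bar> powr (2 / real n))) * (\<bar>u\<bar> powr (1 / real n)) ^ (2 * m)) \<partial>lborel)"
    unfolding mu_kn_def by (subst nn_integral_density) (auto simp: c_def \<alpha>_def)
  also have "\<dots> = 2 * (\<integral>\<^sup>+ u. ennreal (c * \<bar>u\<bar> powr (2 * k + 2 / real n - 2)) *
         ennreal (exp (- (b * \<bar>u\<bar> powr (2 / real n))) * (\<bar>u\<bar> powr (1 / real n)) ^ (2 * m)) * indicator {0<..} u \<partial>lborel)"
    by (rule nn_integral_lborel_even) auto
  also have "\<dots> = 2 * (\<integral>\<^sup>+ u. ennreal (c * (u powr (s - 1) * exp (- (b * u powr e)))) * indicator {0<..} u \<partial>lborel)"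
  proof (intro arg_cong[where f = "(*) 2"] nn_integral_cong)
    fix u :: real
    have "ennreal (c * \<bar>u\<bar> powr (2 * k + 2 / real n - 2)) *
         ennreal (exp (- (b * \<bar>u\<bar> powr (2 / real n))) * (\<bar>u\<bar> powr (1 / real n)) ^ (2 * m))
       = ennreal (c * (u powr (s - 1) * exp (- (b * u powr e))))" if u: "u > 0"
    proof -
      have "(u powr (1 / real n)) ^ (2 * m) = u powr (2 * real m / real n)"
        using u by (simp add: powr_powr flip: powr_realpow)
      then show ?thesis
        using u c unfolding s1 powr_add by (simp add: e_def mult_ac flip: ennreal_mult)
    qed
    then show "ennreal (c * \<bar>u\<bar> powr (2 * k + 2 / real n - 2)) *
         ennreal (exp (- (b * \<bar>u\<bar> powr (2 / real n))) * (\<bar>u\<bar> powr (1 / real n)) ^ (2 * m)) * indicator {0<..} u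
       = ennreal (c * (u powr (s - 1) * exp (- (b * u powr e)))) * indicator {0<..} u"
      by (cases "u > 0") auto
  qed
  also have "\<dots> = 2 * ennreal (c * (Gamma (s / e) / (e * b powr (s / e))))"
    using c has_integral_mult_right[OF has_integral_powr_exp_powr[OF s b e], of c]
    by (subst nn_integral_has_integral_lebesgue') auto
  also have "\<dots> = ennreal (2 * (c * (Gamma (s / e) / (e * b powr (s / e)))))"
    using c e b G by (subst ennreal_mult) (auto simp: se)
  also have "2 * (c * (Gamma (s / e) / (e * b powr (s / e)))) = gaussian_mass k n b * Gamma (\<alpha> + real m + 1) / b ^ m"
    unfolding se using b n0
    by (simp add: e_def c_def gaussian_mass_def powr_add powr_realpow mult_ac flip: \<alpha>_def)
  finally show ?thesis by (simp add: \<alpha>_def)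
qed

lemma gaussian_mass_nonneg:
  assumes "n \<ge> 1" "k \<ge> (real n - 1) / (2 * real n)"
  shows "0 \<le> gaussian_mass k n b"
  using alpha_kn_ge[OF assms] by (simp add: gaussian_mass_def)

text \<open>All terms are nonnegative, so sum and integral may be interchanged. The factor
  \<open>Gamma (\<alpha> + m + 1)\<close> of the Gaussian moment cancels the one in the denominator
  of the coefficient, and what remains is the exponential series in
  \<open>x^2 / (4 * b)\<close>.\<close>

lemma nn_integral_gaussian_bessel_i:
  assumes n: "n \<ge> 1" and k: "k \<ge> (real n - 1) / (2 * real n)" and b: "b > 0"
  shows "(\<integral>\<^sup>+ u. ennreal (exp (- (b * \<bar>u\<bar> powr (2 / real n))) *
            bessel_i (alpha_kn k n) (x * \<bar>u\<bar> powr (1 / real n))) \<partial>mu_kn k n)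
     = ennreal (gaussian_mass k n b * Gamma (alpha_kn k n + 1) * exp (x\<^sup>2 / (4 * b)))"
proof -
  define \<alpha> where "\<alpha> = alpha_kn k n"
  have \<alpha>: "\<alpha> \<ge> -1/2" using alpha_kn_ge[OF n k] by (simp add: \<alpha>_def)
  define D where "D = gaussian_mass k n b"
  have D: "D \<ge> 0" using gaussian_mass_nonneg[OF n k] by (simp add: D_def)
  have G0: "Gamma (\<alpha> + 1) > 0" using \<alpha> by auto
  define c where "c m = beta_moment \<alpha> m / fact (2 * m) * x ^ (2 * m)" for m
  have c: "c m \<ge> 0" for m unfolding c_def by (rule bessel_i_term_nonneg[OF \<alpha>])
  let ?g = "\<lambda>m u. exp (- (b * \<bar>u\<bar> powr (2 / real n))) * (\<bar>u\<bar> powr (1 / real n)) ^ (2 * m)"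
  have "(\<integral>\<^sup>+ u. ennreal (exp (- (b * \<bar>u\<bar> powr (2 / real n))) *
            bessel_i \<alpha> (x * \<bar>u\<bar> powr (1 / real n))) \<partial>mu_kn k n)
     = (\<integral>\<^sup>+ u. (\<Sum>m. ennreal (c m * ?g m u)) \<partial>mu_kn k n)"
  proof (rule nn_integral_cong)
    fix u :: real
    have "(\<lambda>m. exp (- (b * \<bar>u\<bar> powr (2 / real n))) * (beta_moment \<alpha> m / fact (2 * m) * (x * \<bar>u\<bar> powr (1 / real n)) ^ (2 * m)))
       sums (exp (- (b * \<bar>u\<bar> powr (2 / real n))) * bessel_i \<alpha> (x * \<bar>u\<bar> powr (1 / real n)))"
      by (intro sums_mult bessel_i_sums \<alpha>)
    then have "(\<lambda>m. c m * ?g m u) sums (exp (- (b * \<bar>u\<bar> powr (2 / real n))) * bessel_i \<alpha> (x * \<bar>u\<bar> powr (1 / real n)))"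
      by (simp add: c_def power_mult_distrib mult_ac)
    then have "(\<Sum>m. ennreal (c m * ?g m u)) = ennreal (exp (- (b * \<bar>u\<bar> powr (2 / real n))) * bessel_i \<alpha> (x * \<bar>u\<bar> powr (1 / real n)))"
      using c by (subst suminf_ennreal2) (auto simp: sums_iff)
    then show "ennreal (exp (- (b * \<bar>u\<bar> powr (2 / real n))) * bessel_i \<alpha> (x * \<bar>u\<bar> powr (1 / real n)))
      = (\<Sum>m. ennreal (c m * ?g m u))" ..
  qed
  also have "\<dots> = (\<Sum>m. \<integral>\<^sup>+ u. ennreal (c m * ?g m u) \<partial>mu_kn k n)"
    by (rule nn_integral_suminf) auto
  also have "\<dots> = (\<Sum>m. ennreal (D * Gamma (\<alpha> + 1) * ((x\<^sup>2 / (4 * b)) ^ m / fact m)))"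
  proof (rule suminf_cong)
    fix m
    have G: "Gamma (\<alpha> + real m + 1) > 0" using \<alpha> by auto
    have "(\<integral>\<^sup>+ u. ennreal (c m * ?g m u) \<partial>mu_kn k n) = ennreal (c m) * (\<integral>\<^sup>+ u. ennreal (?g m u) \<partial>mu_kn k n)"
      using c by (subst nn_integral_cmult[symmetric]) (auto simp: ennreal_mult)
    also have "\<dots> = ennreal (c m * (D * Gamma (\<alpha> + real m + 1) / b ^ m))"
      unfolding gaussian_moment_mu_kn[OF n k b] using c D G b
      by (subst ennreal_mult) (auto simp: \<alpha>_def D_def)
    also have "c m * (D * Gamma (\<alpha> + real m + 1) / b ^ m) = D * Gamma (\<alpha> + 1) * ((x\<^sup>2 / (4 * b)) ^ m / fact m)"
    proof -
      have "(1/2 :: real) ^ (2 * m) = (1/4) ^ m" "x ^ (2 * m) = (x\<^sup>2) ^ m"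
        by (simp_all add: power_mult power_divide)
      then have "c m = Gamma (\<alpha> + 1) / (fact m * Gamma (\<alpha> + real m + 1)) * (1/4) ^ m * (x\<^sup>2) ^ m"
        unfolding c_def beta_moment_Gamma[OF \<alpha>] by (simp only:)
      then show ?thesis
        using G b by (simp add: power_divide power_mult_distrib mult_ac)
    qed
    finally show "(\<integral>\<^sup>+ u. ennreal (c m * ?g m u) \<partial>mu_kn k n) = ennreal (D * Gamma (\<alpha> + 1) * ((x\<^sup>2 / (4 * b)) ^ m / fact m))" .
  qed
  also have "\<dots> = ennreal (D * Gamma (\<alpha> + 1) * exp (x\<^sup>2 / (4 * b)))"
  proof -
    have "(\<lambda>m. y ^ m / fact m) sums exp y" for y :: real
      using exp_converges[of y] by (simp add: divide_inverse mult.commute)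
    then have "(\<lambda>m. D * Gamma (\<alpha> + 1) * ((x\<^sup>2 / (4 * b)) ^ m / fact m)) sums (D * Gamma (\<alpha> + 1) * exp (x\<^sup>2 / (4 * b)))"
      by (rule sums_mult)
    then show ?thesis
      using D G0 b by (subst suminf_ennreal2) (auto simp: sums_iff)
  qed
  finally show ?thesis by (simp add: \<alpha>_def D_def)
qed

section \<open>Gaussian estimates for weighted \<open>L^p\<close> functions\<close>

lemma gaussian_bessel_i_le:
  assumes "\<alpha> \<ge> -1/2" "b > 0"
  shows "exp (- (b * r\<^sup>2)) * bessel_i \<alpha> (x * r) \<le> exp (x\<^sup>2 / (4 * b))"
proof -
  \<comment> \<open>Completing the square: the maximum of \<open>\<bar>x * r\<bar> - b * r^2\<close>
    over \<open>r\<close> is \<open>x^2 / (4 * b)\<close>, the same exponent as in the integral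
    \<open>nn_integral_gaussian_bessel_i\<close>.\<close>
  have "0 \<le> (2 * b * \<bar>r\<bar> - \<bar>x\<bar>)\<^sup>2 / (4 * b)" using assms by simp
  also have "\<dots> = b * r\<^sup>2 - \<bar>x * r\<bar> + x\<^sup>2 / (4 * b)"
    using assms by (simp add: power2_diff power_mult_distrib abs_mult field_simps power2_eq_square)
  finally have "- (b * r\<^sup>2) + \<bar>x * r\<bar> \<le> x\<^sup>2 / (4 * b)" by simp
  then have "exp (- (b * r\<^sup>2)) * exp \<bar>x * r\<bar> \<le> exp (x\<^sup>2 / (4 * b))"
    by (simp flip: exp_add)
  moreover have "exp (- (b * r\<^sup>2)) * bessel_i \<alpha> (x * r) \<le> exp (- (b * r\<^sup>2)) * exp \<bar>x * r\<bar>"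
    by (intro mult_left_mono bessel_i_le_exp assms) auto
  ultimately show ?thesis by linarith
qed

text \<open>Removes the exponent from all later arguments: the constant absorbs the values below 1
  and \<open>H\<close> is the \<open>p\<close>-th power of the norm, or 0 when
  \<open>p = \<infinity>\<close>.\<close>

lemma in_Lp_le_const_plus_integrable:
  assumes "1 \<le> p" "in_Lp M p g"
  obtains C H where "0 \<le> C" "integrable M H" "\<And>x. 0 \<le> H x" "AE x in M. norm (g x) \<le> C + H x"
proof (cases "p = \<infinity>")
  case True
  with assms obtain C where "AE x in M. norm (g x) \<le> C"
    by (auto simp: in_Lp_def)
  \<comment> \<open>The essential bound in \<open>in_Lp\<close> carries no sign condition, hence the
    absolute value.\<close>
  then have "AE x in M. norm (g x) \<le> \<bar>C\<bar> + 0" by eventually_elim auto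
  then show ?thesis by (intro that[of "\<bar>C\<bar>" "\<lambda>_. 0"]) auto
next
  case False
  define q where "q = enn2real p"
  have q: "q \<ge> 1"
    using assms(1) False enn2real_mono[of 1 p] by (simp add: q_def less_top)
  have "t \<le> 1 + t powr q" if "t \<ge> 0" for t
  proof (cases "t \<le> 1")
    case True
    then show ?thesis using powr_ge_zero[of t q] by linarith
  next
    case False
    then have "t powr 1 \<le> t powr q" using q by (intro powr_mono) auto
    then show ?thesis using False by simp
  qed
  then show ?thesis
    using assms False by (intro that[of 1 "\<lambda>x. norm (g x) powr q"]) (auto simp: in_Lp_def q_def)
qed

text \<open>With \<open>E\<close> the Gaussian and \<open>B\<close> the Bessel factor,
  \<open>norm (f u) * B x u\<close> is at most \<open>E * B * (C + H)\<close>. The exact integral of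
  \<open>E * B\<close> handles \<open>C\<close>, its pointwise bound handles \<open>H\<close>, and
  both give the same exponential.\<close>

lemma nn_integral_even_part_bessel_i:
  fixes f :: "real \<Rightarrow> complex"
  assumes n: "n \<ge> 1" and k: "k \<ge> (real n - 1) / (2 * real n)" and p: "1 \<le> p" and b: "b > 0"
    and f [measurable]: "f \<in> borel_measurable borel"
    and Lp: "in_Lp (mu_kn k n) p (\<lambda>x. complex_of_real (exp (b * \<bar>x\<bar> powr (2 / real n))) * f x)"
  obtains K where "0 \<le> K" "\<And>x. (\<integral>\<^sup>+ u. ennreal (norm (even_part f u) *
      bessel_i (alpha_kn k n) (x * \<bar>u\<bar> powr (1 / real n))) \<partial>mu_kn k n) \<le> ennreal (K * exp (x\<^sup>2 / (4 * b)))"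
proof -
  define \<alpha> where "\<alpha> = alpha_kn k n"
  have \<alpha>: "\<alpha> \<ge> -1/2" using alpha_kn_ge[OF n k] by (simp add: \<alpha>_def)
  let ?M = "mu_kn k n"
  obtain C H where C: "0 \<le> C" and H: "integrable ?M H" "\<And>x. 0 \<le> H x"
    and CH: "AE x in ?M. norm (complex_of_real (exp (b * \<bar>x\<bar> powr (2 / real n))) * f x) \<le> C + H x"
    using in_Lp_le_const_plus_integrable[OF p Lp] by blast
  have [measurable]: "H \<in> borel_measurable borel"
    using borel_measurable_integrable[OF H(1)] by simp
  define D where "D = gaussian_mass k n b * Gamma (\<alpha> + 1)"
  have D: "D \<ge> 0" using gaussian_mass_nonneg[OF n k] \<alpha> by (simp add: D_def)
  \<comment> \<open>\<open>C * D\<close> comes from the constant part and the integral of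
    \<open>H\<close> from the integrable part.\<close>
  define K where "K = C * D + (\<integral>u. H u \<partial>?M)"
  have IH: "0 \<le> (\<integral>u. H u \<partial>?M)" using H(2) by (intro Bochner_Integration.integral_nonneg)
  define B where "B x u = bessel_i \<alpha> (x * \<bar>u\<bar> powr (1 / real n))" for x u :: real
  have B0: "B x u \<ge> 0" for x u unfolding B_def by (rule bessel_i_nonneg[OF \<alpha>])
  have Beven: "B x (- u) = B x u" for x u by (simp add: B_def)
  have [measurable]: "B x \<in> borel_measurable borel" for x unfolding B_def by measurable
  define E where "E u = exp (- (b * \<bar>u\<bar> powr (2 / real n)))" for u :: real
  have [measurable]: "E \<in> borel_measurable borel" unfolding E_def by measurable
  have E0: "E u \<ge> 0" for u by (simp add: E_def)
  have EB: "E u * B x u \<le> exp (x\<^sup>2 / (4 * b))" for x u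
  proof -
    \<comment> \<open>At \<open>u = 0\<close> this rests on the convention
      \<open>0 powr x = 0\<close>.\<close>
    have "(\<bar>u\<bar> powr (1 / real n))\<^sup>2 = \<bar>u\<bar> powr (2 / real n)"
      by (cases "u = 0") (auto simp: powr_powr simp flip: powr_realpow)
    then show ?thesis
      using gaussian_bessel_i_le[OF \<alpha> b, of "\<bar>u\<bar> powr (1 / real n)" x] by (simp add: E_def B_def)
  qed
  have f_bound: "(\<integral>\<^sup>+ u. ennreal (norm (f u) * B x u) \<partial>?M) \<le> ennreal (K * exp (x\<^sup>2 / (4 * b)))" for x
  proof -
    let ?e = "exp (x\<^sup>2 / (4 * b))"
    have "(\<integral>\<^sup>+ u. ennreal (norm (f u) * B x u) \<partial>?M)
        \<le> (\<integral>\<^sup>+ u. ennreal C * ennreal (E u * B x u) + ennreal ?e * ennreal (H u) \<partial>?M)"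
    proof (rule nn_integral_mono_AE)
      show "AE u in ?M. ennreal (norm (f u) * B x u) \<le> ennreal C * ennreal (E u * B x u) + ennreal ?e * ennreal (H u)"
        using CH
      proof eventually_elim
        case (elim u)
        have "norm (f u) = E u * norm (complex_of_real (exp (b * \<bar>u\<bar> powr (2 / real n))) * f u)"
          by (simp add: E_def norm_mult exp_minus)
        also have "\<dots> \<le> E u * (C + H u)"
          by (intro mult_left_mono elim E0)
        finally have "norm (f u) * B x u \<le> E u * (C + H u) * B x u"
          by (intro mult_right_mono B0)
        also have "\<dots> = C * (E u * B x u) + E u * B x u * H u"
          by (simp add: algebra_simps)
        also have "\<dots> \<le> C * (E u * B x u) + ?e * H u"
          by (intro add_left_mono mult_right_mono EB H(2))
        finally show ?case
          using C E0 B0 H(2) by (simp flip: ennreal_mult ennreal_plus)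
      qed
    qed
    also have "\<dots> = ennreal C * (\<integral>\<^sup>+ u. ennreal (E u * B x u) \<partial>?M) + ennreal ?e * (\<integral>\<^sup>+ u. ennreal (H u) \<partial>?M)"
      by (subst nn_integral_add) (auto simp: nn_integral_cmult)
    also have "(\<integral>\<^sup>+ u. ennreal (E u * B x u) \<partial>?M) = ennreal (D * ?e)"
      unfolding E_def B_def D_def \<alpha>_def by (rule nn_integral_gaussian_bessel_i[OF n k b])
    also have "(\<integral>\<^sup>+ u. ennreal (H u) \<partial>?M) = ennreal (\<integral>u. H u \<partial>?M)"
      using H by (intro nn_integral_eq_integral) auto
    also have "ennreal C * ennreal (D * ?e) + ennreal ?e * ennreal (\<integral>u. H u \<partial>?M) = ennreal (K * ?e)"
      using C D IH by (simp add: K_def algebra_simps flip: ennreal_mult ennreal_plus)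
    finally show ?thesis .
  qed
  \<comment> \<open>Since \<open>B\<close> is even and \<open>mu_kn\<close> is invariant under
    reflection, averaging \<open>f u\<close> and \<open>f (- u)\<close> leaves the constant
    \<open>K\<close> unchanged.\<close>
  have "(\<integral>\<^sup>+ u. ennreal (norm (even_part f u) * B x u) \<partial>?M) \<le> ennreal (K * exp (x\<^sup>2 / (4 * b)))" for x
  proof -
    let ?h = "\<lambda>u. ennreal (norm (f u) * B x u)"
    have "(\<integral>\<^sup>+ u. ennreal (norm (even_part f u) * B x u) \<partial>?M) \<le> (\<integral>\<^sup>+ u. ennreal (1/2) * (?h u + ?h (- u)) \<partial>?M)"
    proof (rule nn_integral_mono)
      fix u
      have "norm (even_part f u) * B x u \<le> (norm (f u) + norm (f (- u))) / 2 * B x u"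
        by (intro mult_right_mono B0) (simp add: even_part_def norm_divide norm_triangle_ineq)
      also have "\<dots> = 1/2 * (norm (f u) * B x u + norm (f (- u)) * B x (- u))"
        by (simp add: Beven algebra_simps)
      finally have "ennreal (norm (even_part f u) * B x u)
          \<le> ennreal (1/2 * (norm (f u) * B x u + norm (f (- u)) * B x (- u)))"
        by (rule ennreal_leI)
      also have "\<dots> = ennreal (1/2) * (?h u + ?h (- u))"
        using B0 by (subst ennreal_mult) auto
      finally show "ennreal (norm (even_part f u) * B x u) \<le> ennreal (1/2) * (?h u + ?h (- u))" .
    qed
    also have "\<dots> = ennreal (1/2) * ((\<integral>\<^sup>+ u. ?h u \<partial>?M) + (\<integral>\<^sup>+ u. ?h (- u) \<partial>?M))"
      by (subst nn_integral_cmult) (auto simp: nn_integral_add)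
    also have "(\<integral>\<^sup>+ u. ?h (- u) \<partial>?M) = (\<integral>\<^sup>+ u. ?h u \<partial>?M)"
      by (rule nn_integral_mu_kn_reflect) auto
    also have "ennreal (1/2) * ((\<integral>\<^sup>+ u. ?h u \<partial>?M) + (\<integral>\<^sup>+ u. ?h u \<partial>?M)) = (\<integral>\<^sup>+ u. ?h u \<partial>?M)"
    proof -
      have "ennreal (1/2) * (t + t) = t" for t :: ennreal
      proof (cases t)
        case (real r)
        then have "ennreal (1/2) * (t + t) = ennreal (1/2 * (r + r))"
          by (simp only: ennreal_mult ennreal_plus add_nonneg_nonneg)
        then show ?thesis by (simp add: real)
      qed (simp add: ennreal_mult_top)
      then show ?thesis .
    qed
    finally show ?thesis using f_bound[of x] by (rule order_trans)
  qed
  moreover have "K \<ge> 0" using C D IH by (simp add: K_def)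
  ultimately show ?thesis
    using that[of K] by (simp add: B_def \<alpha>_def)
qed

section \<open>The transform as an entire function\<close>

lemma everywhere_convergent_power_series_holomorphic:
  fixes c :: "nat \<Rightarrow> complex"
  assumes "\<And>w. summable (\<lambda>m. c m * w ^ m)"
  shows "(\<lambda>w. \<Sum>m. c m * w ^ m) holomorphic_on UNIV"
  unfolding holomorphic_on_def field_differentiable_def
  using termdiffs_strong_converges_everywhere[OF assms] by auto

theorem lemma2p1:
  fixes n :: nat and k a :: real and p :: ennreal and f :: "real \<Rightarrow> complex"
  assumes "n \<ge> 1"
    and "k \<ge> (real n - 1) / (2 * real n)"
    and "1 \<le> p"
    and "a > 0"
    and "f \<in> borel_measurable lborel"
    and "in_Lp (mu_kn k n) p (\<lambda>x. complex_of_real (exp (real n * a * \<bar>x\<bar> powr (2 / real n))) * f x)"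
  shows "(\<forall>z. integrable (mu_kn k n) (T1_integrand k n f z))
    \<and> (T1 k n f) holomorphic_on UNIV
    \<and> (\<exists>C>0. \<forall>z. norm (T1 k n f z) \<le> C * exp (real n / (4 * a) * (Im z)\<^sup>2))"
proof (intro conjI allI)
  let ?M = "mu_kn k n"
  define \<alpha> where "\<alpha> = alpha_kn k n"
  have \<alpha>: "\<alpha> \<ge> -1/2" using alpha_kn_ge[OF assms(1,2)] by (simp add: \<alpha>_def)
  define r where "r u = \<bar>u\<bar> powr (1 / real n)" for u :: real
  have [measurable]: "r \<in> borel_measurable borel" unfolding r_def by measurable
  have [measurable]: "f \<in> borel_measurable borel" using assms(5) by simp
  have [measurable]: "even_part f \<in> borel_measurable borel" unfolding even_part_def by measurable
  \<comment> \<open>One family of majorants with two uses: \<open>x = n * Im z\<close> bounds the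
    integrand itself, and \<open>x = n * norm z\<close> bounds its series of absolute
    values.\<close>
  define \<phi> where "\<phi> x u = norm (even_part f u) * bessel_i \<alpha> (x * r u)" for x u :: real
  have \<phi>_nonneg: "\<phi> x u \<ge> 0" for x u by (simp add: \<phi>_def bessel_i_nonneg[OF \<alpha>])
  have [measurable]: "\<phi> x \<in> borel_measurable borel" for x unfolding \<phi>_def by measurable
  have b: "real n * a > 0" using assms by simp
  obtain K where K: "0 \<le> K" "\<And>x. (\<integral>\<^sup>+ u. ennreal (\<phi> x u) \<partial>?M) \<le> ennreal (K * exp (x\<^sup>2 / (4 * (real n * a))))"
    unfolding \<phi>_def r_def \<alpha>_def
    using nn_integral_even_part_bessel_i[OF assms(1,2,3) b _ assms(6)] by auto
  have \<phi>_int: "integrable ?M (\<phi> x)" for x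
  proof (rule integrableI_nonneg)
    show "(\<integral>\<^sup>+ u. ennreal (\<phi> x u) \<partial>?M) < \<infinity>"
      using K(2)[of x] by (auto intro: le_less_trans)
  qed (auto simp: \<phi>_nonneg)
  have \<phi>_le: "(\<integral>u. \<phi> x u \<partial>?M) \<le> K * exp (x\<^sup>2 / (4 * (real n * a)))" for x
  proof -
    have "ennreal (\<integral>u. \<phi> x u \<partial>?M) \<le> ennreal (K * exp (x\<^sup>2 / (4 * (real n * a))))"
      using K(2)[of x] \<phi>_int[of x] \<phi>_nonneg by (subst nn_integral_eq_integral[symmetric]) auto
    then show ?thesis using K(1) by (simp add: ennreal_le_iff)
  qed
  have T1_eq: "T1_integrand k n f z u = even_part f u * bessel_j \<alpha> (of_nat n * z * complex_of_real (r u))" for z u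
    by (simp add: T1_integrand_def \<alpha>_def r_def)
  have [measurable]: "T1_integrand k n f z \<in> borel_measurable borel" for z
    unfolding T1_eq[abs_def] by measurable
  have T1_le: "norm (T1_integrand k n f z u) \<le> \<phi> (real n * Im z) u" for z u
    unfolding T1_eq \<phi>_def norm_mult
    using norm_bessel_j_le[OF \<alpha>, of "of_nat n * z * complex_of_real (r u)"]
    by (intro mult_left_mono) auto
  show T1_int: "integrable ?M (T1_integrand k n f z)" for z
    by (rule Bochner_Integration.integrable_bound[OF \<phi>_int[of "real n * Im z"]])
      (use T1_le \<phi>_nonneg in \<open>auto intro: order_trans[OF _ abs_ge_self]\<close>)

  show "\<exists>C>0. \<forall>z. norm (T1 k n f z) \<le> C * exp (real n / (4 * a) * (Im z)\<^sup>2)"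
  \<comment> \<open>\<open>K\<close> may vanish, whereas the constant has to be positive.\<close>
  proof (intro exI[of _ "K + 1"] conjI allI)
    fix z
    have "norm (T1 k n f z) \<le> (\<integral>u. norm (T1_integrand k n f z u) \<partial>?M)"
      unfolding T1_def by (rule integral_norm_bound)
    also have "\<dots> \<le> (\<integral>u. \<phi> (real n * Im z) u \<partial>?M)"
      by (intro integral_mono integrable_norm T1_int \<phi>_int T1_le)
    also have "\<dots> \<le> K * exp ((real n * Im z)\<^sup>2 / (4 * (real n * a)))"
      by (rule \<phi>_le)
    also have "(real n * Im z)\<^sup>2 / (4 * (real n * a)) = real n / (4 * a) * (Im z)\<^sup>2"
      using assms(1) by (simp add: power_mult_distrib power2_eq_square)
    also have "K * exp (real n / (4 * a) * (Im z)\<^sup>2) \<le> (K + 1) * exp (real n / (4 * a) * (Im z)\<^sup>2)"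
      by (intro mult_right_mono) auto
    finally show "norm (T1 k n f z) \<le> (K + 1) * exp (real n / (4 * a) * (Im z)\<^sup>2)" .
  qed (use K(1) in simp)

  \<comment> \<open>The part of the \<open>m\<close>-th term that does not depend on
    \<open>z\<close>; the variable enters only through \<open>z^2\<close>.\<close>
  define h where "h m u = even_part f u * complex_of_real ((-1) ^ m * (beta_moment \<alpha> m / fact (2 * m)) * (real n * r u) ^ (2 * m))" for m u
  have [measurable]: "h m \<in> borel_measurable borel" for m unfolding h_def by measurable
  have T1_series: "(\<lambda>m. (\<integral>u. h m u \<partial>?M) * (z\<^sup>2) ^ m) sums T1 k n f z" for z
  proof -
    let ?g = "\<lambda>m u. h m u * (z\<^sup>2) ^ m"
    have g_sums: "(\<lambda>m. ?g m u) sums T1_integrand k n f z u" for u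
    proof -
      have "(\<lambda>m. even_part f u * (complex_of_real ((-1) ^ m * (beta_moment \<alpha> m / fact (2 * m))) *
          (of_nat n * z * complex_of_real (r u)) ^ (2 * m))) sums T1_integrand k n f z u"
        unfolding T1_eq by (intro sums_mult bessel_j_sums \<alpha>)
      then show ?thesis
        by (simp add: h_def power_mult_distrib mult_ac flip: power_mult)
    qed
    have norm_g: "norm (?g m u) = norm (even_part f u) *
        (beta_moment \<alpha> m / fact (2 * m) * (real n * norm z * r u) ^ (2 * m))" for m u
      using beta_moment_nonneg[OF \<alpha>, of m]
      by (simp add: h_def norm_mult norm_power norm_divide power_mult_distrib mult_ac flip: power_mult)
        (simp add: r_def mult.commute)
    \<comment> \<open>The absolute values add up to the majorant exactly, so it bounds every partial
      sum. This yields both the integrability of each term and the bound on the sums of their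
      integrals.\<close>
    have norm_sums: "(\<lambda>m. norm (?g m u)) sums \<phi> (real n * norm z) u" for u
      unfolding norm_g \<phi>_def by (intro sums_mult bessel_i_sums \<alpha>)
    have partial: "(\<Sum>m\<in>A. norm (?g m u)) \<le> \<phi> (real n * norm z) u" if "finite A" for A u
      using norm_sums[of u] that sum_le_suminf[of "\<lambda>m. norm (?g m u)" A] by (auto simp: sums_iff)
    have g_int: "integrable ?M (?g m)" for m
      by (rule Bochner_Integration.integrable_bound[OF \<phi>_int[of "real n * norm z"]])
        (use partial[of "{m}"] in \<open>auto intro: order_trans[OF _ abs_ge_self]\<close>)
    have summ: "summable (\<lambda>m. \<integral>u. norm (?g m u) \<partial>?M)"
    proof (rule summableI_nonneg_bounded)
      fix N
      have "(\<Sum>m<N. \<integral>u. norm (?g m u) \<partial>?M) = (\<integral>u. (\<Sum>m<N. norm (?g m u)) \<partial>?M)"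
        by (rule Bochner_Integration.integral_sum[symmetric]) (intro integrable_norm g_int)
      also have "\<dots> \<le> (\<integral>u. \<phi> (real n * norm z) u \<partial>?M)"
        by (intro integral_mono Bochner_Integration.integrable_sum integrable_norm g_int \<phi>_int partial) auto
      finally show "(\<Sum>m<N. \<integral>u. norm (?g m u) \<partial>?M) \<le> (\<integral>u. \<phi> (real n * norm z) u \<partial>?M)" .
    qed auto
    have "(\<lambda>m. \<integral>u. ?g m u \<partial>?M) sums (\<integral>u. (\<Sum>m. ?g m u) \<partial>?M)"
      using norm_sums by (intro sums_integral g_int summ AE_I2) (auto simp: sums_iff)
    also have "(\<lambda>u. \<Sum>m. ?g m u) = T1_integrand k n f z"
      using g_sums by (auto simp: sums_iff)
    finally show ?thesis
      by (simp add: T1_def)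
  qed
  \<comment> \<open>Every \<open>w\<close> is the square of \<open>csqrt w\<close>, so convergence
    at all \<open>z^2\<close> is convergence everywhere; the transform is then an entire function
    composed with squaring.\<close>
  have "summable (\<lambda>m. (\<integral>u. h m u \<partial>?M) * w ^ m)" for w
    using T1_series[of "csqrt w"] by (simp add: sums_iff)
  then have "(\<lambda>w. \<Sum>m. (\<integral>u. h m u \<partial>?M) * w ^ m) holomorphic_on UNIV"
    by (rule everywhere_convergent_power_series_holomorphic)
  then have "(\<lambda>w. \<Sum>m. (\<integral>u. h m u \<partial>?M) * w ^ m) \<circ> (\<lambda>z. z\<^sup>2) holomorphic_on UNIV"
    by (intro holomorphic_on_compose holomorphic_intros) (auto intro: holomorphic_on_subset)
  also have "(\<lambda>w. \<Sum>m. (\<integral>u. h m u \<partial>?M) * w ^ m) \<circ> (\<lambda>z. z\<^sup>2) = T1 k n f"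
    using T1_series by (auto simp: sums_iff fun_eq_iff)
  finally show "T1 k n f holomorphic_on UNIV" .
qed

end
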